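(* The Faulhaber polynomials $F_n$ ($n\ge 2$) satisfy the following recurrences: $$n F_{n-1}(y) = 3\,\theta_{y,\frac12} F_n(y)\qquad (n\ge 3 \text{ odd}),$$ $$n y^2 F_{n-1}(y) = \tfrac16\,\theta_y\bigl(F_n(y)-F_n(0)\bigr) + 2y\,\theta_{y,\frac23}F_n(y)\qquad (n\ge 4\text{ even}).$$ In particular, $F_n(0)=\mathfrak{f}_{n,0}=6\mathbf{B}_n$ if $n\ge 2$ is even, and $F_n(0)=\mathfrak{f}_{n,0}=2n\mathbf{B}_{n-1}$ if $n\ge 3$ is odd, where $(-1)^{\mathbf{d}_n}F_n(0)>0$ for all $n\ge2$; moreover $F_n(1)=\mathfrak{f}_{n,0}+\dots+\mathfrak{f}_{n,\mathbf{d}_n}=1$ for all $n\ge 2$.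
   Context: Bernoulli polynomials: $\frac{te^{xt}}{e^t-1}=\sum_{n\ge0}\mathbf{B}_n(x)\frac{t^n}{n!}$, and $\mathbf{B}_n=\mathbf{B}_n(0)$ (so $\mathbf{B}_1=-\frac12$). Power sums: $S_n(x)=\frac{1}{n+1}(\mathbf{B}_{n+1}(x)-\mathbf{B}_{n+1})$ for $n\ge0$, so that $S_n(m)=\sum_{\nu=0}^{m-1}\nu^n$; in particular $S_1(x)=\binom{x}{2}=x(x-1)/2$. Faulhaber polynomials (classical Faulhaber–Jacobi theorem): for each $n\ge2$ there is a unique polynomial $F_n\in\mathbb{Q}[y]$, of degree $\mathbf{d}_n=\lfloor n/2\rfloor-1$, such that $S_n(x)=S_2(x)\,F_n(S_1(x))$ if $n$ is even and $S_n(x)=S_1(x)^2\,F_n(S_1(x))$ if $n$ is odd. Its coefficients are denoted $F_n(y)=\sum_{k=0}^{\mathbf{d}_n}\mathfrak{f}_{n,k}\,y^k$. Differential operators: $\theta_{y,\alpha}=1+\alpha\,y\,\frac{d}{dy}$ and $\theta_y=\theta_{y,1}$. *)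

theory Defs
  imports "HOL-Computational_Algebra.Computational_Algebra"
begin

(* The value B_n(x), read off from the generating function t e^{xt} / (e^t - 1).
   Division is that of formal power series: numerator and denominator both have
   subdegree 1, so the quotient is exact (bernoulli_poly_generating_function). *)
definition bernoulli_poly :: "nat \<Rightarrow> rat \<Rightarrow> rat" where
  "bernoulli_poly n x = fact n * fps_nth (fps_X * fps_exp x / (fps_exp 1 - 1)) n"

lemma bernoulli_poly_generating_function:
  "Abs_fps (\<lambda>n. bernoulli_poly n x / fact n) * (fps_exp 1 - 1) = fps_X * fps_exp x"
proof -
  let ?g = "fps_exp (1::rat) - 1"
  have eq: "Abs_fps (\<lambda>n. bernoulli_poly n x / fact n) = fps_X * fps_exp x / ?g"
    by (simp add: bernoulli_poly_def fps_eq_iff)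
  have sub: "subdegree ?g = 1"
    by (rule subdegreeI) auto
  then have nz: "?g \<noteq> 0"
    by auto
  have "subdegree (fps_X * fps_exp x) \<ge> 1"
    by (intro subdegree_geI) (auto simp: fps_eq_iff intro!: exI[of _ 1])
  then have "?g dvd fps_X * fps_exp x"
    using sub nz by (simp add: fps_dvd_iff)
  then show ?thesis
    unfolding eq by simp
qed

definition bernoulli_number :: "nat \<Rightarrow> rat" where
  "bernoulli_number n = bernoulli_poly n 0"

definition power_sum :: "nat \<Rightarrow> rat \<Rightarrow> rat" where
  "power_sum n x = (bernoulli_poly (n + 1) x - bernoulli_number (n + 1)) / of_nat (n + 1)"

definition faulhaber_degree :: "nat \<Rightarrow> nat" where
  "faulhaber_degree n = n div 2 - 1"

(* Only meaningful for n >= 2, where the Faulhaber-Jacobi theorem gives existence and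
   uniqueness. An identity of polynomials over the rationals is the same as an identity
   of their values at all rational x. *)
definition faulhaber :: "nat \<Rightarrow> rat poly" where
  "faulhaber n = (THE F. degree F = faulhaber_degree n \<and>
     (\<forall>x. power_sum n x =
        (if even n then power_sum 2 x * poly F (power_sum 1 x)
         else (power_sum 1 x)\<^sup>2 * poly F (power_sum 1 x))))"

(* theta_{y,alpha} = 1 + alpha y d/dy; the polynomial [:0, 1:] is the variable y. *)
definition theta :: "rat \<Rightarrow> rat poly \<Rightarrow> rat poly" where
  "theta \<alpha> p = p + smult \<alpha> ([:0, 1:] * pderiv p)"

end

theory Submission
  imports Defs
begin

text \<open>
  Write \<open>y = S\<^sub>1\<close>, so that \<open>S\<^sub>2 = 2/3 y y'\<close>, \<open>y'' = 1\<close> and \<open>y'\<^sup>2 = 2 y + 1/4\<close>. Hence the derivatives of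
  \<open>y\<^sup>2 F(y)\<close> and \<open>S\<^sub>2 F(y)\<close> are obtained from \<open>F\<close> by the differential operators on the right-hand
  sides of the two recurrences. On the other hand \<open>S\<^sub>n' = n S\<^sub>n\<^sub>-\<^sub>1 + B\<^sub>n\<close>. The recurrences are
  triangular systems for the coefficients of \<open>F\<^sub>n\<close>, hence solvable given \<open>F\<^sub>n\<^sub>-\<^sub>1\<close>. For a solution
  \<open>F\<close>, the difference of \<open>S\<^sub>n\<close> and the expression in \<open>F(S\<^sub>1)\<close> has constant derivative and vanishes
  at 0 and 1, so it is zero; this yields the existence of \<open>F\<^sub>n\<close>, the recurrence, and the value
  \<open>F\<^sub>n(0)\<close> simultaneously. The sign of \<open>F\<^sub>n(0)\<close> is that of a Bernoulli number, which is read off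
  from Euler's quadratic recurrence.
\<close>

section \<open>Bernoulli numbers\<close>

definition bernoulli_fps :: "rat fps" where
  "bernoulli_fps = Abs_fps (\<lambda>n. bernoulli_number n / fact n)"

lemma bernoulli_fps_mult: "bernoulli_fps * (fps_exp 1 - 1) = fps_X"
  using bernoulli_poly_generating_function[of 0]
  by (simp add: bernoulli_fps_def bernoulli_number_def)

text \<open>Both series have the product \<open>fps_X * fps_exp x\<close> with
  \<open>fps_exp 1 - 1\<close>. This factor can be cancelled: it is nonzero because
  \<open>bernoulli_fps_mult\<close> makes it divide \<open>fps_X\<close>.\<close>

lemma bernoulli_poly_fps: "Abs_fps (\<lambda>n. bernoulli_poly n x / fact n) = bernoulli_fps * fps_exp x"
proof -
  let ?A = "Abs_fps (\<lambda>n. bernoulli_poly n x / fact n)"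
  have "(?A - bernoulli_fps * fps_exp x) * (fps_exp 1 - 1)
      = ?A * (fps_exp 1 - 1) - (bernoulli_fps * (fps_exp 1 - 1)) * fps_exp x"
    by (simp only: algebra_simps)
  also have "\<dots> = 0"
    by (simp add: bernoulli_fps_mult bernoulli_poly_generating_function)
  finally show ?thesis
    using bernoulli_fps_mult by (auto simp: fps_X_neq_zero)
qed

lemma bernoulli_poly_sum:
  "bernoulli_poly n x = (\<Sum>k\<le>n. of_nat (n choose k) * bernoulli_number (n - k) * x ^ k)"
proof -
  have "bernoulli_poly n x / fact n = (fps_exp x * bernoulli_fps) $ n"
    by (simp flip: bernoulli_poly_fps add: mult.commute[of "fps_exp x"])
  then have "bernoulli_poly n x
      = fact n * (\<Sum>k\<le>n. x ^ k / fact k * (bernoulli_number (n - k) / fact (n - k)))"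
    by (simp add: fps_mult_nth bernoulli_fps_def atLeast0AtMost field_simps)
  then show ?thesis
    by (simp add: sum_distrib_left binomial_fact mult_ac)
qed

lemma bernoulli_number_0: "bernoulli_number 0 = 1"
  and bernoulli_number_1: "bernoulli_number 1 = -1/2"
  and bernoulli_number_2: "bernoulli_number 2 = 1/6"
proof -
  \<comment> \<open>Since e^t - 1 starts with t, coefficient n + 1 is the one that determines B_n
    from its predecessors.\<close>
  have nth: "(bernoulli_fps * (fps_exp 1 - 1)) $ n = (fps_X :: rat fps) $ n" for n
    by (simp add: bernoulli_fps_mult)
  show 0: "bernoulli_number 0 = 1"
    using nth[of 1] by (simp add: fps_mult_nth bernoulli_fps_def)
  show 1: "bernoulli_number 1 = -1/2"
    using nth[of 2] 0 by (simp add: fps_mult_nth bernoulli_fps_def numeral_2_eq_2)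
  show "bernoulli_number 2 = 1/6"
    using nth[of 3] 0 1
    by (simp add: fps_mult_nth bernoulli_fps_def numeral_2_eq_2 numeral_3_eq_3)
qed

section \<open>Euler's quadratic recurrence and the signs of the Bernoulli numbers\<close>

lemma bernoulli_fps_ode:
  "fps_X * fps_deriv bernoulli_fps = bernoulli_fps - bernoulli_fps * (bernoulli_fps + fps_X)"
proof -
  let ?g = bernoulli_fps and ?E = "fps_exp (1::rat)"
  have "fps_deriv (?g * (?E - 1)) = 1"
    by (simp add: bernoulli_fps_mult)
  then have "fps_deriv ?g * (?E - 1) + ?g * ?E = 1"
    by (simp add: algebra_simps)
  \<comment> \<open>Multiplying by g lets both occurrences of e^t be absorbed through g (e^t - 1) =
    t.\<close>
  then have "?g * (fps_deriv ?g * (?E - 1) + ?g * ?E) = ?g"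
    by simp
  also have "?g * (fps_deriv ?g * (?E - 1) + ?g * ?E)
      = fps_deriv ?g * (?g * (?E - 1)) + ?g * (?g * (?E - 1) + ?g)"
    by (simp only: algebra_simps mult_1_left mult_1_right)
  finally have "fps_deriv ?g * fps_X + ?g * (fps_X + ?g) = ?g"
    by (simp only: bernoulli_fps_mult)
  then show ?thesis
    by (simp add: algebra_simps)
qed

text \<open>Adding \<open>t/2\<close> removes the only odd-index coefficient, that of \<open>B\<^sub>1\<close>.\<close>

definition bernoulli_even_fps :: "rat fps" where
  "bernoulli_even_fps = bernoulli_fps + fps_const (1/2) * fps_X"

text \<open>This completes the square: g^2 + t g = (g + t/2)^2 - t^2/4.\<close>

lemma bernoulli_even_fps_ode:
  "fps_X * fps_deriv bernoulli_even_fps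
     = bernoulli_even_fps - bernoulli_even_fps * bernoulli_even_fps + fps_const (1/4) * fps_X ^ 2"
proof -
  let ?h = "fps_const (1/2 :: rat)"
  have h: "?h + ?h = 1" "fps_const (1/4) = ?h * ?h"
    by (simp_all flip: fps_const_add)
  have "fps_X * fps_deriv bernoulli_even_fps = fps_X * fps_deriv bernoulli_fps + ?h * fps_X"
    by (simp add: bernoulli_even_fps_def algebra_simps)
  also have "\<dots> = bernoulli_fps - bernoulli_fps * bernoulli_fps
      - (?h + ?h) * bernoulli_fps * fps_X + ?h * fps_X"
    unfolding bernoulli_fps_ode h(1) by (simp add: algebra_simps)
  also have "\<dots> = bernoulli_even_fps - bernoulli_even_fps * bernoulli_even_fps
      + ?h * ?h * fps_X ^ 2"
    unfolding bernoulli_even_fps_def by (simp only: algebra_simps power2_eq_square)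
  finally show ?thesis
    by (simp only: h(2))
qed

lemma bernoulli_even_fps_nth_0: "bernoulli_even_fps $ 0 = 1"
  by (simp add: bernoulli_even_fps_def bernoulli_fps_def bernoulli_number_0)

lemma bernoulli_even_fps_nth: "n \<noteq> 1 \<Longrightarrow> bernoulli_even_fps $ n = bernoulli_number n / fact n"
  by (simp add: bernoulli_even_fps_def bernoulli_fps_def)

text \<open>Compare coefficients of t^n in the differential equation. The term t^2/4 is invisible
  from n = 3 on, and the two end terms of the convolution contribute twice the n-th coefficient,
  which moves to the left.\<close>

lemma bernoulli_even_fps_rec:
  assumes "n \<ge> 3"
  shows "of_nat (n + 1) * bernoulli_even_fps $ n
       = - (\<Sum>i=1..n-1. bernoulli_even_fps $ i * bernoulli_even_fps $ (n - i))"
proof -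
  let ?f = "\<lambda>i. bernoulli_even_fps $ i"
  obtain m where m: "n = Suc m" "m > 0"
    using assms by (cases n) auto
  have "of_nat n * ?f n = ?f n - (\<Sum>i=0..n. ?f i * ?f (n - i))"
    using arg_cong[OF bernoulli_even_fps_ode, of "\<lambda>g. g $ n"] assms
    by (simp add: m fps_mult_nth[of bernoulli_even_fps] fps_X_power_nth)
  also have "(\<Sum>i=0..n. ?f i * ?f (n - i)) = 2 * ?f n + (\<Sum>i=1..n-1. ?f i * ?f (n - i))"
    by (simp add: m sum.atLeast_Suc_atMost[of 0] bernoulli_even_fps_nth_0)
  finally show ?thesis
    by (simp add: algebra_simps)
qed

text \<open>For odd n, one of i and n - i is odd and smaller than n, so every product in the
  recurrence vanishes by induction.\<close>

lemma bernoulli_even_fps_odd: "odd n \<Longrightarrow> bernoulli_even_fps $ n = 0"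
proof (induction n rule: less_induct)
  case (less n)
  show ?case
  proof (cases "n = 1")
    case True
    then show ?thesis
      using bernoulli_number_1 by (simp add: bernoulli_even_fps_def bernoulli_fps_def)
  next
    case False
    with less.prems have n: "n \<ge> 3"
      by presburger
    have "bernoulli_even_fps $ i * bernoulli_even_fps $ (n - i) = 0" if "i \<in> {1..n-1}" for i
      using that less by (cases "odd i") (auto intro!: less.IH)
    then have "(\<Sum>i=1..n-1. bernoulli_even_fps $ i * bernoulli_even_fps $ (n - i)) = 0"
      by (intro sum.neutral ballI)
    then have "of_nat (n + 1) * bernoulli_even_fps $ n = 0"
      by (simp only: bernoulli_even_fps_rec[OF n] minus_zero)
    then show ?thesis
      by (simp del: of_nat_Suc add: of_nat_eq_0_iff)
  qed
qed

text \<open>Splitting (-1)^m as (-1)^j (-1)^(m-j) makes each even-index product a product of two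
  negative numbers; the minus sign in the recurrence then propagates negativity.\<close>

lemma bernoulli_even_fps_sign: "m \<ge> 1 \<Longrightarrow> (-1) ^ m * bernoulli_even_fps $ (2 * m) < 0"
proof (induction m rule: less_induct)
  case (less m)
  let ?f = "\<lambda>i. bernoulli_even_fps $ i"
  show ?case
  proof (cases "m = 1")
    case True
    then show ?thesis
      by (simp add: bernoulli_even_fps_nth bernoulli_number_2)
  next
    case False
    with less.prems have m: "m \<ge> 2"
      by simp
    have pos: "(-1) ^ m * (?f (2 * j) * ?f (2 * m - 2 * j)) > 0" if "1 \<le> j" "j < m" for j
    proof -
      have "((-1) ^ j * ?f (2 * j)) * ((-1) ^ (m - j) * ?f (2 * (m - j))) > 0"
        using that by (intro mult_neg_neg less.IH) auto
      moreover have "(-1 :: rat) ^ m = (-1) ^ j * (-1) ^ (m - j)"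
        using that by (simp flip: power_add)
      moreover have "2 * (m - j) = 2 * m - 2 * j"
        by simp
      ultimately show ?thesis
        by (simp only: mult_ac)
    qed
    have "(\<Sum>i=1..2*m-1. (-1) ^ m * (?f i * ?f (2 * m - i))) > 0"
    \<comment> \<open>One strictly positive term suffices; index 2 is in range because m is at least
      2, and the odd indices contribute 0.\<close>
    proof (rule sum_pos2[of _ 2])
      show "(-1) ^ m * (?f 2 * ?f (2 * m - 2)) > 0"
        using pos[of 1] m by simp
      show "(-1) ^ m * (?f i * ?f (2 * m - i)) \<ge> 0" if "i \<in> {1..2*m-1}" for i
      proof (cases "odd i")
        case True
        then show ?thesis
          by (simp add: bernoulli_even_fps_odd)
      next
        case False
        then obtain j where j: "i = 2 * j"
          by (auto elim: evenE)
        with that m have "1 \<le> j" "j < m"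
          by auto
        from pos[OF this] show ?thesis
          by (simp add: j)
      qed
    qed (use m in auto)
    moreover have "of_nat (2 * m + 1) * ((-1) ^ m * ?f (2 * m))
        = - (\<Sum>i=1..2*m-1. (-1) ^ m * (?f i * ?f (2 * m - i)))"
      using bernoulli_even_fps_rec[of "2 * m"] m
      by (simp only: mult.left_commute[of "of_nat _"] sum_distrib_left[symmetric])
    ultimately have "of_nat (2 * m + 1) * ((-1) ^ m * ?f (2 * m)) < 0"
      by linarith
    then show ?thesis
      by (simp add: mult_less_0_iff del: of_nat_add of_nat_Suc)
  qed
qed

lemma bernoulli_number_sign:
  assumes "even n" "n \<ge> 2"
  shows "(-1) ^ (n div 2 - 1) * bernoulli_number n > 0"
proof -
  obtain k where n: "n = 2 * Suc k"
    using assms by (metis One_nat_def Suc_le_D dvdE mult_eq_0_iff not_numeral_le_zero not0_implies_Suc)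
  have "(-1) ^ Suc k * (bernoulli_number n / fact n) < 0"
    using bernoulli_even_fps_sign[of "Suc k"] by (simp add: bernoulli_even_fps_nth n del: fact_Suc)
  then show ?thesis
    using assms by (simp add: n zero_less_divide_iff del: fact_Suc)
qed

section \<open>Power sums as polynomials\<close>

text \<open>A polynomial object in place of a function of x, so that degree, \<open>pderiv\<close>
  and \<open>pcompose\<close> apply.\<close>

definition bernoulli_polynomial :: "nat \<Rightarrow> rat poly" where
  "bernoulli_polynomial n = (\<Sum>k\<le>n. monom (of_nat (n choose k) * bernoulli_number (n - k)) k)"

lemma poly_bernoulli_polynomial: "poly (bernoulli_polynomial n) x = bernoulli_poly n x"
  by (simp add: bernoulli_polynomial_def bernoulli_poly_sum poly_sum poly_monom)

lemma coeff_bernoulli_polynomial: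
  "coeff (bernoulli_polynomial n) k = of_nat (n choose k) * bernoulli_number (n - k)"
  by (auto simp: bernoulli_polynomial_def coeff_sum coeff_monom binomial_eq_0)

lemma pderiv_bernoulli_polynomial:
  "pderiv (bernoulli_polynomial (Suc n)) = smult (of_nat (Suc n)) (bernoulli_polynomial n)"
proof (rule poly_eqI)
  fix k
  have "of_nat (Suc k) * of_nat (Suc n choose Suc k) = (of_nat (Suc n) * of_nat (n choose k) :: rat)"
    by (metis Suc_times_binomial of_nat_mult)
  then show "coeff (pderiv (bernoulli_polynomial (Suc n))) k
      = coeff (smult (of_nat (Suc n)) (bernoulli_polynomial n)) k"
    by (simp add: coeff_pderiv coeff_bernoulli_polynomial mult.assoc[symmetric] del: of_nat_Suc binomial_Suc_Suc)
qed

lemma degree_bernoulli_polynomial: "degree (bernoulli_polynomial n) = n"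
proof (rule antisym)
  show "degree (bernoulli_polynomial n) \<le> n"
    by (rule degree_le) (simp add: coeff_bernoulli_polynomial binomial_eq_0)
  show "n \<le> degree (bernoulli_polynomial n)"
    by (rule le_degree) (simp add: coeff_bernoulli_polynomial bernoulli_number_0)
qed

text \<open>This difference equation comes from g (e^t - 1) = t; it yields the values of the power
  sums at 1 and 2.\<close>

lemma bernoulli_poly_plus_1: "bernoulli_poly (Suc n) (x + 1) = bernoulli_poly (Suc n) x + of_nat (Suc n) * x ^ n"
proof -
  have "bernoulli_fps * fps_exp (x + 1) - bernoulli_fps * fps_exp x
      = (bernoulli_fps * (fps_exp 1 - 1)) * fps_exp x"
    by (simp add: fps_exp_add_mult algebra_simps)
  also have "\<dots> = fps_X * fps_exp x"
    by (simp add: bernoulli_fps_mult)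
  finally have "(Abs_fps (\<lambda>n. bernoulli_poly n (x + 1) / fact n)
      - Abs_fps (\<lambda>n. bernoulli_poly n x / fact n)) $ Suc n = (fps_X * fps_exp x) $ Suc n"
    by (simp only: bernoulli_poly_fps)
  then have "bernoulli_poly (Suc n) (x + 1) / fact (Suc n)
      = bernoulli_poly (Suc n) x / fact (Suc n) + x ^ n / fact n"
    by (simp del: fact_Suc add: algebra_simps)
  then show ?thesis
    by (simp add: field_simps del: of_nat_Suc)
qed

lemma power_sum_0: "power_sum n 0 = 0"
  by (simp add: power_sum_def bernoulli_number_def)

lemma power_sum_plus_1: "power_sum n (x + 1) = power_sum n x + x ^ n"
  by (simp add: power_sum_def bernoulli_poly_plus_1 diff_divide_distrib add_divide_distrib del: of_nat_Suc)

lemma power_sum_1: "n \<ge> 1 \<Longrightarrow> power_sum n 1 = 0"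
  using power_sum_plus_1[of n 0] by (simp add: power_sum_0)

text \<open>At x = 2 the argument S_1 of F_n is itself 1, so this point gives access to
  F_n(1).\<close>

lemma power_sum_2: "n \<ge> 1 \<Longrightarrow> power_sum n 2 = 1"
  using power_sum_plus_1[of n 1] by (simp add: power_sum_1)

definition power_sum_poly :: "nat \<Rightarrow> rat poly" where
  "power_sum_poly n
     = smult (1 / of_nat (n + 1)) (bernoulli_polynomial (n + 1) - [:bernoulli_number (n + 1):])"

lemma poly_power_sum_poly: "poly (power_sum_poly n) x = power_sum n x"
  by (simp add: power_sum_poly_def power_sum_def poly_bernoulli_polynomial)

lemma pderiv_power_sum_poly:
  assumes "n \<ge> 1"
  shows "pderiv (power_sum_poly n) = smult (of_nat n) (power_sum_poly (n - 1)) + [:bernoulli_number n:]"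
proof -
  have "pderiv (power_sum_poly n) = bernoulli_polynomial n"
    by (simp add: power_sum_poly_def pderiv_smult pderiv_diff pderiv_pCons
        pderiv_bernoulli_polynomial del: of_nat_Suc)
  then show ?thesis
    using assms by (simp add: power_sum_poly_def)
qed

lemma degree_power_sum_poly: "degree (power_sum_poly n) = n + 1"
proof -
  have "degree (bernoulli_polynomial (n + 1) - [:bernoulli_number (n + 1):]) = n + 1"
    by (subst diff_conv_add_uminus, subst degree_add_eq_left) (simp_all add: degree_bernoulli_polynomial)
  then show ?thesis
    by (simp add: power_sum_poly_def del: of_nat_Suc)
qed

lemma power_sum_poly_nonzero: "power_sum_poly n \<noteq> 0"
  using degree_power_sum_poly[of n] by auto

lemma power_sum_poly_1: "power_sum_poly 1 = [:0, -1/2, 1/2:]"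
  using bernoulli_number_0 bernoulli_number_1
  by (simp add: power_sum_poly_def bernoulli_polynomial_def numeral_2_eq_2 monom_altdef)

lemma power_sum_poly_2: "power_sum_poly 2 = [:0, 1/6, -1/2, 1/3:]"
  using bernoulli_number_0 bernoulli_number_1 bernoulli_number_2
  by (simp add: power_sum_poly_def bernoulli_polynomial_def numeral_2_eq_2 numeral_3_eq_3 monom_altdef)

section \<open>Faulhaber polynomials\<close>

text \<open>The defining identity is stated between polynomials; the degree of F follows from it in
  \<open>degree_is_faulhaber\<close>.\<close>

definition is_faulhaber :: "nat \<Rightarrow> rat poly \<Rightarrow> bool" where
  "is_faulhaber n F \<longleftrightarrow> power_sum_poly n
     = (if even n then power_sum_poly 2 else (power_sum_poly 1)\<^sup>2) * pcompose F (power_sum_poly 1)"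

lemma is_faulhaber_iff:
  "is_faulhaber n F \<longleftrightarrow> (\<forall>x. power_sum n x =
     (if even n then power_sum 2 x * poly F (power_sum 1 x)
      else (power_sum 1 x)\<^sup>2 * poly F (power_sum 1 x)))"
  unfolding is_faulhaber_def poly_eq_poly_eq_iff[symmetric] fun_eq_iff
  by (simp add: poly_pcompose poly_power_sum_poly)

lemma degree_is_faulhaber:
  assumes "is_faulhaber n F" "n \<ge> 2"
  shows "degree F = faulhaber_degree n"
proof -
  let ?y = "power_sum_poly 1"
  have deg: "degree ?y = 2" "degree (power_sum_poly 2) = 3" "degree (?y\<^sup>2) = 4"
    by (simp_all add: degree_power_sum_poly degree_mult_eq power_sum_poly_nonzero power2_eq_square)
  have "pcompose F ?y \<noteq> 0"
    using assms(1) power_sum_poly_nonzero[of n] by (auto simp: is_faulhaber_def)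
  then have "n + 1 = (if even n then 3 else 4) + 2 * degree F"
    using arg_cong[OF assms(1)[unfolded is_faulhaber_def], of degree] deg
    by (auto simp: degree_power_sum_poly degree_mult_eq degree_pcompose power_sum_poly_nonzero)
  then show ?thesis
    unfolding faulhaber_degree_def by presburger
qed

text \<open>After cancelling the nonzero prefactor, composition with the nonconstant polynomial S_1
  is injective.\<close>

lemma is_faulhaber_unique:
  assumes "is_faulhaber n F" "is_faulhaber n G"
  shows "F = G"
proof -
  have "pcompose F (power_sum_poly 1) = pcompose G (power_sum_poly 1)"
    using assms by (auto simp: is_faulhaber_def power_sum_poly_nonzero split: if_splits)
  then have "pcompose (F - G) (power_sum_poly 1) = 0"
    by (simp add: pcompose_diff)
  then show ?thesis
    using pcompose_eq_0[of "F - G" "power_sum_poly 1"] degree_power_sum_poly[of 1] by simp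
qed

lemma faulhaber_eqI:
  assumes "is_faulhaber n F" "n \<ge> 2"
  shows "faulhaber n = F"
  unfolding faulhaber_def
  by (rule the_equality)
    (use assms in \<open>auto simp flip: is_faulhaber_iff intro: degree_is_faulhaber is_faulhaber_unique\<close>)

section \<open>Solvability of the recurrences\<close>

lemma ex_poly_bidiagonal:
  fixes a b :: "nat \<Rightarrow> 'a::field"
  assumes "\<And>k. a k \<noteq> 0"
  shows "\<exists>F. \<forall>k. a k * coeff F k + b k * coeff F (Suc k) = coeff Q k"
  using assms
proof (induction Q arbitrary: a b rule: pCons_induct)
  case 0
  show ?case
    by (rule exI[of _ 0]) simp
next
  case (pCons q Q)
  \<comment> \<open>The system is upper triangular: solve the shifted system for the higher
    coefficients first, then divide by a_0 to get the lowest one. Inducting on Q keeps the solution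
    finite.\<close>
  obtain F where F: "\<And>k. a (Suc k) * coeff F k + b (Suc k) * coeff F (Suc k) = coeff Q k"
    using pCons.IH[of "\<lambda>k. a (Suc k)" "\<lambda>k. b (Suc k)"] pCons.prems by auto
  have "a k * coeff (pCons ((q - b 0 * coeff F 0) / a 0) F) k
      + b k * coeff (pCons ((q - b 0 * coeff F 0) / a 0) F) (Suc k) = coeff (pCons q Q) k" for k
    using F pCons.prems[of 0] by (cases k) auto
  then show ?case
    by blast
qed

lemma coeff_theta: "coeff (theta \<alpha> p) k = (1 + \<alpha> * of_nat k) * coeff p k"
  by (cases k) (auto simp: theta_def coeff_pderiv algebra_simps)

lemma theta_surj:
  assumes "\<alpha> \<ge> 0"
  shows "\<exists>p. theta \<alpha> p = q"
proof -
  have "0 < 1 + \<alpha> * of_nat k" for k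
    using assms by (intro add_pos_nonneg) auto
  then have "1 + \<alpha> * of_nat k \<noteq> 0" for k
    by (metis less_irrefl)
  from ex_poly_bidiagonal[of "\<lambda>k. 1 + \<alpha> * of_nat k" "\<lambda>_. 0" q, OF this]
  show ?thesis
    by (auto simp: poly_eq_iff coeff_theta)
qed

lemma even_recurrence_surj:
  "\<exists>F. smult (1/6) (theta 1 (F - [:poly F 0:])) + smult 2 ([:0, 1:] * theta (2/3) F) = [:0, 1:] * Q"
proof -
  have "0 < 2 * (1 + 2/3 * of_nat k :: rat)" for k
    by (intro mult_pos_pos add_pos_nonneg) auto
  then have "2 * (1 + 2/3 * of_nat k) \<noteq> (0 :: rat)" for k
    by (metis less_irrefl)
  \<comment> \<open>Removing F(0) makes the left side divisible by y. In the coefficient of y^(k+1),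
    \<open>theta 1\<close> contributes the factor 1 + (k+1), whence (k+2)/6.\<close>
  from ex_poly_bidiagonal[of "\<lambda>k. 2 * (1 + 2/3 * of_nat k) :: rat" "\<lambda>k. (of_nat k + 2) / 6" Q, OF this]
  obtain F where F: "\<And>k. 2 * (1 + 2/3 * of_nat k) * coeff F k
      + (of_nat k + 2) / 6 * coeff F (Suc k) = coeff Q k"
    by auto
  have "coeff (smult (1/6) (theta 1 (F - [:poly F 0:])) + smult 2 ([:0, 1:] * theta (2/3) F)) k
      = coeff ([:0, 1:] * Q) k" for k
    using F by (cases k) (auto simp: coeff_theta poly_0_coeff_0 algebra_simps simp flip: F)
  then show ?thesis
    by (auto simp: poly_eq_iff)
qed

text \<open>Such a p is affine with two zeros. The conclusion c = 0 is kept because it later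
  evaluates F_n(0) for even n.\<close>

lemma poly_eq_0_if_pderiv_const:
  fixes p :: "'a::field_char_0 poly"
  assumes "pderiv p = [:c:]" "poly p 0 = 0" "poly p 1 = 0"
  shows "c = 0" "p = 0"
proof -
  have "pderiv (p - [:0, c:]) = 0"
    by (simp add: pderiv_diff pderiv_pCons assms(1))
  then have "degree (p - [:0, c:]) = 0"
    by (simp add: pderiv_eq_0_iff)
  then obtain d where "p - [:0, c:] = [:d:]"
    by (auto elim: degree_eq_zeroE)
  then have p: "p = [:d, c:]"
    by (simp add: diff_eq_eq)
  then show "c = 0" "p = 0"
    using assms by auto
qed

section \<open>Derivatives of S_1^2 F(S_1) and S_2 F(S_1)\<close>

lemma poly_pderiv_odd_form:
  "poly (pderiv ((power_sum_poly 1)\<^sup>2 * pcompose F (power_sum_poly 1))) x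
     = 3 * power_sum 2 x * poly (theta (1/2) F) (power_sum 1 x)"
proof -
  define y where "y = power_sum 1 x"
  have y': "poly (pderiv (power_sum_poly 1)) x = x - 1/2"
    by (simp add: power_sum_poly_1 pderiv_pCons del: One_nat_def)
  have S2: "power_sum 2 x = 2/3 * y * (x - 1/2)"
    unfolding y_def poly_power_sum_poly[symmetric] power_sum_poly_1 power_sum_poly_2
    by (simp add: field_simps)
  \<comment> \<open>The derivative is y' (2 y F + y^2 F') = 2 y y' (F + y F'/2), and 2 y y' = 3
    S_2.\<close>
  show ?thesis
    unfolding y_def[symmetric] S2
    by (simp add: y' theta_def pderiv_mult pderiv_pcompose poly_pcompose poly_power_sum_poly
        y_def[symmetric] power2_eq_square algebra_simps del: One_nat_def)
qed

lemma poly_pderiv_even_form: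
  "poly (pderiv (power_sum_poly 2 * pcompose F (power_sum_poly 1))) x
     = poly (smult (1/6) (theta 1 (F - [:poly F 0:])) + smult 2 ([:0, 1:] * theta (2/3) F))
         (power_sum 1 x) + poly F 0 / 6"
proof -
  define y where "y = power_sum 1 x"
  have y: "y = (x\<^sup>2 - x) / 2"
    unfolding y_def poly_power_sum_poly[symmetric] power_sum_poly_1
    by (simp add: field_simps power2_eq_square)
  have y': "poly (pderiv (power_sum_poly 1)) x = x - 1/2"
    by (simp add: power_sum_poly_1 pderiv_pCons del: One_nat_def)
  have S2': "poly (pderiv (power_sum_poly 2)) x = 2 * y + 1/6"
    by (simp add: power_sum_poly_2 pderiv_pCons y field_simps power2_eq_square)
  have S2: "power_sum 2 x * (x - 1/2) = 2/3 * y * (2 * y + 1/4)"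
    unfolding y poly_power_sum_poly[symmetric] power_sum_poly_2
    by (simp add: field_simps power2_eq_square)
  have "poly (pderiv (power_sum_poly 2 * pcompose F (power_sum_poly 1))) x
      = poly (pderiv F) y * (power_sum 2 x * (x - 1/2)) + (2 * y + 1/6) * poly F y"
    by (simp add: pderiv_mult pderiv_pcompose poly_pcompose poly_power_sum_poly
        y' S2' y_def[symmetric] del: One_nat_def)
  \<comment> \<open>Group (2y + 1/6) F + (4/3 y^2 + y/6) F' by the factors 1/6 and 2y; the last
    summand restores the F(0) subtracted inside \<open>theta 1\<close>.\<close>
  also have "\<dots> = poly (smult (1/6) (theta 1 (F - [:poly F 0:]))
      + smult 2 ([:0, 1:] * theta (2/3) F)) y + poly F 0 / 6"
    unfolding S2 by (simp add: theta_def pderiv_diff pderiv_pCons field_simps)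
  finally show ?thesis
    by (simp only: y_def)
qed

section \<open>Existence of the Faulhaber polynomials and the recurrences\<close>

lemma is_faulhaber_odd_step:
  assumes "odd n" "n \<ge> 3" "is_faulhaber (n - 1) F"
  shows "\<exists>G. is_faulhaber n G \<and> smult (of_nat n) F = smult 3 (theta (1/2) G)"
proof -
  obtain G where G: "theta (1/2) G = smult (of_nat n / 3) F"
    using theta_surj[of "1/2"] by auto
  let ?p = "power_sum_poly n - (power_sum_poly 1)\<^sup>2 * pcompose G (power_sum_poly 1)"
  have "poly (pderiv ?p) x = bernoulli_number n" for x
  proof -
    have "poly (pderiv ?p) x = of_nat n * power_sum (n - 1) x + bernoulli_number n
        - of_nat n * power_sum 2 x * poly F (power_sum 1 x)"
      using assms(2) by (simp add: pderiv_diff poly_pderiv_odd_form G pderiv_power_sum_poly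
          poly_power_sum_poly del: One_nat_def)
    \<comment> \<open>As n - 1 is even, this cancels everything except the constant B_n.\<close>
    also have "power_sum (n - 1) x = power_sum 2 x * poly F (power_sum 1 x)"
      using assms by (auto simp: is_faulhaber_iff)
    finally show ?thesis
      by simp
  qed
  then have "pderiv ?p = [:bernoulli_number n:]"
    by (intro poly_eq_poly_eq_iff[THEN iffD1]) auto
  then have "?p = 0"
    by (rule poly_eq_0_if_pderiv_const)
      (use assms(2) in \<open>simp_all add: poly_power_sum_poly power_sum_0 power_sum_1\<close>)
  then have "is_faulhaber n G"
    using assms(1) by (simp add: is_faulhaber_def)
  with G show ?thesis
    by auto
qed

lemma is_faulhaber_even_step:
  assumes "even n" "n \<ge> 4" "is_faulhaber (n - 1) F"
  shows "\<exists>G. is_faulhaber n G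
    \<and> smult (of_nat n) ([:0, 1:]\<^sup>2 * F)
        = smult (1/6) (theta 1 (G - [:poly G 0:])) + smult 2 ([:0, 1:] * theta (2/3) G)
    \<and> poly G 0 = 6 * bernoulli_number n"
proof -
  \<comment> \<open>Apply surjectivity with Q = n y F, so that the right-hand side is n y^2
    F.\<close>
  obtain G where "smult (1/6) (theta 1 (G - [:poly G 0:])) + smult 2 ([:0, 1:] * theta (2/3) G)
      = [:0, 1:] * ([:0, 1:] * smult (of_nat n) F)"
    using even_recurrence_surj by blast
  then have G: "smult (1/6) (theta 1 (G - [:poly G 0:])) + smult 2 ([:0, 1:] * theta (2/3) G)
      = smult (of_nat n) ([:0, 1:]\<^sup>2 * F)"
    by (simp add: power2_eq_square)
  let ?p = "power_sum_poly n - power_sum_poly 2 * pcompose G (power_sum_poly 1)"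
  have "poly (pderiv ?p) x = bernoulli_number n - poly G 0 / 6" for x
  proof -
    have "poly (pderiv ?p) x = of_nat n * power_sum (n - 1) x + bernoulli_number n
        - (of_nat n * (power_sum 1 x)\<^sup>2 * poly F (power_sum 1 x) + poly G 0 / 6)"
      using assms(2) by (simp add: pderiv_diff poly_pderiv_even_form[of G, unfolded G]
          pderiv_power_sum_poly
          poly_power_sum_poly del: One_nat_def)
    also have "power_sum (n - 1) x = (power_sum 1 x)\<^sup>2 * poly F (power_sum 1 x)"
      using assms by (auto simp: is_faulhaber_iff)
    finally show ?thesis
      by simp
  qed
  then have d: "pderiv ?p = [:bernoulli_number n - poly G 0 / 6:]"
    by (intro poly_eq_poly_eq_iff[THEN iffD1]) auto
  have "poly ?p 0 = 0" "poly ?p 1 = 0"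
    using assms(2) by (simp_all add: poly_power_sum_poly power_sum_0 power_sum_1)
  \<comment> \<open>The constant derivative must itself be 0, which is the formula for G(0).\<close>
  from poly_eq_0_if_pderiv_const[OF d this]
  have "is_faulhaber n G" "poly G 0 = 6 * bernoulli_number n"
    using assms(1) by (simp_all add: is_faulhaber_def)
  with G show ?thesis
    by auto
qed

lemma is_faulhaber_2: "is_faulhaber 2 1"
  by (simp add: is_faulhaber_def pcompose_1)

text \<open>Existence: start from F_2 = 1 and alternate the odd and even steps; uniqueness
  identifies the polynomial so built with \<open>faulhaber n\<close>.\<close>

lemma is_faulhaber_faulhaber: "n \<ge> 2 \<Longrightarrow> is_faulhaber n (faulhaber n)"
proof (induction n rule: nat_induct_at_least)
  case base
  then show ?case
    using is_faulhaber_2 by (simp add: faulhaber_eqI)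
next
  case (Suc n)
  have "\<exists>G. is_faulhaber (Suc n) G"
  proof (cases "odd n")
    case True
    moreover from this Suc.hyps have "Suc n \<ge> 4"
      by presburger
    ultimately show ?thesis
      using is_faulhaber_even_step[of "Suc n"] Suc.IH by auto
  next
    case False
    then show ?thesis
      using is_faulhaber_odd_step[of "Suc n"] Suc by auto
  qed
  then show ?case
    using Suc.hyps by (auto simp: faulhaber_eqI)
qed

lemma faulhaber_odd_recurrence:
  assumes "odd n" "n \<ge> 3"
  shows "smult (of_nat n) (faulhaber (n - 1)) = smult 3 (theta (1/2) (faulhaber n))"
proof -
  have "is_faulhaber (n - 1) (faulhaber (n - 1))"
    using assms by (intro is_faulhaber_faulhaber) simp
  from is_faulhaber_odd_step[OF assms this] show ?thesis
    using assms by (auto simp: faulhaber_eqI)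
qed

lemma faulhaber_even_recurrence:
  assumes "even n" "n \<ge> 4"
  shows "smult (of_nat n) ([:0, 1:]\<^sup>2 * faulhaber (n - 1))
       = smult (1/6) (theta 1 (faulhaber n - [:poly (faulhaber n) 0:]))
         + smult 2 ([:0, 1:] * theta (2/3) (faulhaber n))"
    (is ?thesis1)
    and "poly (faulhaber n) 0 = 6 * bernoulli_number n" (is ?thesis2)
proof -
  have "is_faulhaber (n - 1) (faulhaber (n - 1))"
    using assms by (intro is_faulhaber_faulhaber) simp
  from is_faulhaber_even_step[OF assms this] obtain G where "is_faulhaber n G"
    and G: "smult (of_nat n) ([:0, 1:]\<^sup>2 * faulhaber (n - 1))
        = smult (1/6) (theta 1 (G - [:poly G 0:])) + smult 2 ([:0, 1:] * theta (2/3) G)"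
      "poly G 0 = 6 * bernoulli_number n"
    by blast
  moreover from this assms have "faulhaber n = G"
    by (intro faulhaber_eqI) auto
  ultimately show "?thesis1" "?thesis2"
    by simp_all
qed

section \<open>Values at 0 and 1\<close>

lemma faulhaber_even_0:
  assumes "even n" "n \<ge> 2"
  shows "poly (faulhaber n) 0 = 6 * bernoulli_number n"
proof (cases "n = 2")
  case True
  then show ?thesis
    by (simp add: faulhaber_eqI[OF is_faulhaber_2] bernoulli_number_2)
next
  case False
  with assms have "n \<ge> 4"
    by presburger
  with assms show ?thesis
    by (simp add: faulhaber_even_recurrence)
qed

lemma faulhaber_odd_0:
  assumes "odd n" "n \<ge> 3"
  shows "poly (faulhaber n) 0 = 2 * of_nat n * bernoulli_number (n - 1)"
proof -
  \<comment> \<open>At y = 0 the operator theta acts as the identity.\<close>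
  have "of_nat n * poly (faulhaber (n - 1)) 0 = 3 * poly (faulhaber n) 0"
    using arg_cong[OF faulhaber_odd_recurrence[OF assms], of "\<lambda>p. poly p 0"]
    by (simp add: theta_def)
  then show ?thesis
    using assms by (simp add: faulhaber_even_0)
qed

lemma faulhaber_0_sign:
  assumes "n \<ge> 2"
  shows "(-1) ^ faulhaber_degree n * poly (faulhaber n) 0 > 0"
proof (cases "even n")
  case True
  then show ?thesis
    using bernoulli_number_sign[OF True assms] assms
    by (simp add: faulhaber_even_0 faulhaber_degree_def mult.left_commute)
next
  case False
  \<comment> \<open>For odd n, d_n = d_(n-1), so the sign is inherited from B_(n-1).\<close>
  with assms have n: "n \<ge> 3" "(n - 1) div 2 = n div 2"
    by presburger+
  then have "2 * of_nat n * ((-1) ^ faulhaber_degree n * bernoulli_number (n - 1)) > 0"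
    using bernoulli_number_sign[of "n - 1"] False by (simp add: faulhaber_degree_def)
  then show ?thesis
    using False n by (simp add: faulhaber_odd_0 mult_ac)
qed

lemma poly_faulhaber_1:
  assumes "n \<ge> 2"
  shows "poly (faulhaber n) 1 = 1"
  \<comment> \<open>At x = 2, S_1, S_2 and S_n all equal 1, and the defining identity reduces to 1 =
    F_n(1).\<close>
  using is_faulhaber_faulhaber[OF assms, unfolded is_faulhaber_iff, rule_format, of 2] assms
  by (simp add: power_sum_2 split: if_splits)

lemma poly_faulhaber_1_sum:
  assumes "n \<ge> 2"
  shows "poly (faulhaber n) 1 = (\<Sum>k\<le>faulhaber_degree n. coeff (faulhaber n) k)"
  using degree_is_faulhaber[OF is_faulhaber_faulhaber[OF assms] assms]
  by (simp add: poly_altdef)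

theorem theorem5p1:
  shows "(\<forall>n\<ge>3. odd n \<longrightarrow>
            smult (of_nat n) (faulhaber (n - 1)) = smult 3 (theta (1/2) (faulhaber n)))
       \<and> (\<forall>n\<ge>4. even n \<longrightarrow>
            smult (of_nat n) ([:0, 1:]\<^sup>2 * faulhaber (n - 1))
              = smult (1/6) (theta 1 (faulhaber n - [:poly (faulhaber n) 0:]))
                + smult 2 ([:0, 1:] * theta (2/3) (faulhaber n)))
       \<and> (\<forall>n\<ge>2. even n \<longrightarrow>
            poly (faulhaber n) 0 = coeff (faulhaber n) 0
            \<and> coeff (faulhaber n) 0 = 6 * bernoulli_number n)
       \<and> (\<forall>n\<ge>3. odd n \<longrightarrow>
            poly (faulhaber n) 0 = coeff (faulhaber n) 0
            \<and> coeff (faulhaber n) 0 = 2 * of_nat n * bernoulli_number (n - 1))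
       \<and> (\<forall>n\<ge>2. (-1) ^ faulhaber_degree n * poly (faulhaber n) 0 > 0)
       \<and> (\<forall>n\<ge>2. poly (faulhaber n) 1 = (\<Sum>k\<le>faulhaber_degree n. coeff (faulhaber n) k)
            \<and> (\<Sum>k\<le>faulhaber_degree n. coeff (faulhaber n) k) = 1)"
proof (intro conjI allI impI)
  show "coeff (faulhaber n) 0 = 6 * bernoulli_number n" if "n \<ge> 2" "even n" for n
    using faulhaber_even_0[of n] that by (simp add: poly_0_coeff_0)
  show "coeff (faulhaber n) 0 = 2 * of_nat n * bernoulli_number (n - 1)" if "n \<ge> 3" "odd n" for n
    using faulhaber_odd_0[of n] that by (simp add: poly_0_coeff_0)
  show "(\<Sum>k\<le>faulhaber_degree n. coeff (faulhaber n) k) = 1" if "n \<ge> 2" for n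
    using poly_faulhaber_1[OF that] poly_faulhaber_1_sum[OF that] by simp
qed (rule faulhaber_odd_recurrence faulhaber_even_recurrence(1) faulhaber_0_sign
      poly_faulhaber_1_sum poly_0_coeff_0; assumption)+

end
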